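(* Let $(X,\|\cdot\|)$ be a real Banach space with dual $X'$, let $M$ be a metric space and let $M_0 \subset M$. Let $\Gamma_0 \subset C(M_0, X)$ and define \[ \Gamma=\{ \gamma \in C(M, X): \gamma\vert_{M_0} \in \Gamma_0 \}. \] Suppose that $\varphi \in C^1(X, \mathbb{R})$ satisfies \[ c:=\inf_{\gamma \in \Gamma} \sup_{t\in M} \varphi (\gamma(t)) > a:=\sup_{\gamma_0 \in \Gamma_0} \sup_{t \in M_0} \varphi(\gamma_0(t)), \] with $c\in\mathbb{R}$, and that $\Psi \in C(X, X)$ satisfies $\varphi \circ \Psi \le \varphi$ on $X$ and $\Psi\circ\gamma\in\Gamma$ for every $\gamma\in\Gamma$. Then for every $\varepsilon \in \,]0, \frac{c-a}{2}[$, every $\delta > 0$ and every $\gamma \in \Gamma$ such that \[ \sup_{M} \varphi \circ \gamma \le c+\varepsilon, \] there exist elements $u, v, w \in X$ such that \begin{enumerate} \item $c-2\varepsilon \le \varphi(u) \le c+2\varepsilon$, \item $c-2\varepsilon \le \varphi(v) \le c+2\varepsilon$, \item $\|u-w\| \le 3\delta$, \item $\operatorname{dist}_X(w, \gamma(M)) \le \delta$, \item $\|v-\Psi(w)\| \le 2\delta$, \item $\|\varphi'(u)\|_{X'} < 8\varepsilon/\delta$, \item $\|\varphi'(v)\|_{X'} < 8\varepsilon/\delta$. \end{enumerate}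
   Context: $C(A,B)$ denotes the set of continuous maps from $A$ to $B$. For $\varphi\in C^1(X,\mathbb{R})$ (continuously Fréchet differentiable), $\varphi'(u)\in X'$ denotes the derivative at $u$ and $\|\cdot\|_{X'}$ the dual norm. For $w\in X$ and $A\subset X$, $\operatorname{dist}_X(w,A)=\inf_{x\in A}\|w-x\|$. Suprema and infima are taken in the extended real line (so that $a=-\infty$ is possible, in which case $\frac{c-a}{2}=+\infty$). *)

theory Defs
  imports "HOL-Analysis.Analysis"
begin

(* A map with domain A is represented by the total function that agrees with it on A
   and is undefined elsewhere, so that members of this set correspond bijectively to
   continuous maps A -> B and equality is equality of maps on A.  For A = UNIV the
   extensionality condition is vacuous. *)
definition continuous_maps ::
  "'m::topological_space set \<Rightarrow> 'x::topological_space set \<Rightarrow> ('m \<Rightarrow> 'x) set" where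
  "continuous_maps A B = {f \<in> A \<rightarrow>\<^sub>E B. continuous_on A f}"

definition extension_class ::
  "'m::topological_space set \<Rightarrow> ('m \<Rightarrow> 'x::topological_space) set \<Rightarrow> ('m \<Rightarrow> 'x) set" where
  "extension_class M0 \<Gamma>0 = {\<gamma> \<in> continuous_maps UNIV UNIV. restrict \<gamma> M0 \<in> \<Gamma>0}"

end

theory Submission
  imports Defs
begin

text \<open>
  Let \<open>K\<close> be the set of points at levels \<open>[c - 2\<epsilon>, c + 2\<epsilon>]\<close> with \<open>\<parallel>\<phi>'\<parallel> < 8\<epsilon>/\<delta>\<close>.
  A single deformation \<open>\<eta>\<close> of \<open>{\<phi> \<le> c + \<epsilon>}\<close> moves points by at most \<open>\<delta>\<close>, never raises \<open>\<phi>\<close>, fixes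
  \<open>{\<phi> \<le> c - \<epsilon>}\<close>, and sends every point that has no element of \<open>K\<close> within \<open>2\<delta>\<close> into \<open>{\<phi> \<le> c - \<epsilon>}\<close>.
  The map \<open>\<eta> \<circ> \<Psi> \<circ> \<eta> \<circ> \<gamma>\<close> lies in \<open>\<Gamma>\<close>, hence exceeds the level \<open>c - \<epsilon>\<close> at some \<open>t\<close>. Then
  neither application of \<open>\<eta>\<close> can have been effective: \<open>K\<close> has a point \<open>u\<close> within \<open>2\<delta>\<close> of \<open>\<gamma> t\<close>
  and a point \<open>v\<close> within \<open>2\<delta>\<close> of \<open>\<Psi> w\<close>, where \<open>w = \<eta> (\<gamma> t)\<close>.

  Instead of solving an ODE, \<open>\<eta>\<close> is obtained by Euler steps along a merely continuous
  pseudo-gradient field, with a continuous step size. Locally only a fixed finite number of steps is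
  needed, which makes the result continuous.
\<close>

section \<open>Pseudo-gradient fields\<close>

text \<open>Locally a constant direction works, and the inequality defining \<open>C\<close>
  survives positive combinations. Pieces living at scale \<open>q n\<close> are added with summable
  weights, so uniform convergence takes the place of local finiteness. Normalising the pairing to 1
  makes elapsed time measure, to first order, the loss of level.\<close>

lemma pseudo_gradient:
  fixes A :: "'a::metric_space \<Rightarrow> 'b::banach \<Rightarrow>\<^sub>L real"
  assumes contA: "continuous_on UNIV A"
  obtains w where "continuous_on {x. A x \<noteq> 0} w"
    "\<And>x. A x \<noteq> 0 \<Longrightarrow> blinfun_apply (A x) (w x) = 1"
    "\<And>x. A x \<noteq> 0 \<Longrightarrow> norm (w x) \<le> 2 / norm (A x)"
proof -
  \<comment> \<open>The factor 1/2 leaves room: the dual norm need not be attained on the unit ball.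
    The strict inequality makes \<open>C v\<close> open.\<close>
  define C where "C v = {x. norm (A x) / 2 < blinfun_apply (A x) v}" for v
  have openC: "open (C v)" for v
    unfolding C_def by (intro open_Collect_less continuous_intros contA) auto
  have ex: "\<exists>v. norm v \<le> 1 \<and> x \<in> C v" if "A x \<noteq> 0" for x
  proof (rule ccontr)
    assume no: "\<not> ?thesis"
    have unit: "\<bar>blinfun_apply (A x) v\<bar> \<le> norm (A x) / 2" if "norm v \<le> 1" for v
    proof -
      have "v \<notin> {v. norm (A x) / 2 < blinfun_apply (A x) v}" "- v \<notin> {v. norm (A x) / 2 < blinfun_apply (A x) v}"
        using no that by (auto simp: C_def)
      then show ?thesis by (simp add: blinfun.minus_right abs_le_iff)
    qed
    have "norm (blinfun_apply (A x) v) \<le> norm (A x) / 2 * norm v" for v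
    proof (cases "v = 0")
      case False
      have "\<bar>blinfun_apply (A x) (v /\<^sub>R norm v)\<bar> \<le> norm (A x) / 2"
        by (rule unit) (use False in auto)
      then show ?thesis using False by (simp add: blinfun.scaleR_right abs_mult field_simps)
    qed simp
    then have "norm (A x) \<le> norm (A x) / 2" by (intro norm_blinfun_bound) auto
    with that show False by simp
  qed
  \<comment> \<open>A well-order on directions lets each \<open>x\<close> pick the least direction
    of the unit ball that works at \<open>x\<close>.\<close>
  obtain r :: "'b rel" where r: "well_order_on UNIV r" using well_order_on by blast
  have wf: "wf (r - Id)" and tot: "total r"
    using r unfolding well_order_on_def linear_order_on_def by auto
  have "\<exists>v. norm v \<le> 1 \<and> x \<in> C v \<and> (\<forall>u. (u, v) \<in> r - Id \<longrightarrow> norm u \<le> 1 \<longrightarrow> x \<notin> C u)"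
    if x: "A x \<noteq> 0" for x
  proof -
    obtain v where "v \<in> {v. norm v \<le> 1 \<and> x \<in> C v}" using ex[OF x] by blast
    then show ?thesis
      by (rule wfE_min[OF wf]) blast
  qed
  then obtain a where a: "\<And>x. A x \<noteq> 0 \<Longrightarrow> norm (a x) \<le> 1" "\<And>x. A x \<noteq> 0 \<Longrightarrow> x \<in> C (a x)"
    "\<And>x u. A x \<noteq> 0 \<Longrightarrow> (u, a x) \<in> r - Id \<Longrightarrow> norm u \<le> 1 \<Longrightarrow> x \<notin> C u"
    by metis
  define q :: "nat \<Rightarrow> real" where "q n = (1/2) ^ n" for n
  have q0: "q n > 0" for n by (simp add: q_def)
  define E where "E n = {x. A x \<noteq> 0 \<and> ball x (2 * q n) \<subseteq> C (a x)}" for n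
  text \<open>As in M. E. Rudin's proof of paracompactness, minimality of the index separates
    the pieces of \<open>E n\<close> that belong to different indices.\<close>
  have sep: "a x = a y" if "x \<in> E n" "y \<in> E n" "dist x y < 2 * q n" for n x y
  proof (rule ccontr)
    assume "a x \<noteq> a y"
    then consider "(a x, a y) \<in> r - Id" | "(a y, a x) \<in> r - Id"
      using tot unfolding total_on_def by auto
    then show False
    proof cases
      case 1
      then have "y \<notin> C (a x)" using a that by (auto simp: E_def)
      with that show False by (auto simp: E_def)
    next
      case 2
      then have "x \<notin> C (a y)" using a that by (auto simp: E_def)
      moreover have "x \<in> ball y (2 * q n)" using that(3) by (simp add: dist_commute)
      ultimately show False using that(2) by (auto simp: E_def)
    qed
  qed
  \<comment> \<open>\<open>infdist\<close> to the empty set is 0, so without the case split an empty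
    \<open>E n\<close> would receive the full weight \<open>q n\<close> everywhere.\<close>
  define p where "p n x = (if E n = {} then 0 else max 0 (q n - infdist x (E n)))" for n x
  have contp: "continuous_on S (p n)" for n S
    unfolding p_def by (cases "E n = {}") (auto intro!: continuous_intros)
  have p0: "p n x \<ge> 0" and pq: "p n x \<le> q n" for n x
    using q0[of n] infdist_nonneg[of x "E n"] by (auto simp: p_def less_imp_le)
  have near: "\<exists>e\<in>E n. dist x e < q n" if "p n x > 0" for n x
  proof -
    have ne: "E n \<noteq> {}" and "infdist x (E n) < q n" using that by (auto simp: p_def split: if_splits)
    moreover have "q n \<le> infdist x (E n)" if "\<not> ?thesis"
      unfolding infdist_notempty[OF ne] by (intro cINF_greatest ne) (use that in \<open>auto simp: not_less\<close>)
    ultimately show ?thesis by fastforce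
  qed
  \<comment> \<open>Two points of \<open>E n\<close> within \<open>q n\<close> of \<open>x\<close>
    are less than \<open>2 * q n\<close> apart, so \<open>sep\<close> makes the choice immaterial.
    Hence \<open>b n\<close> is locally constant where \<open>p n\<close> is positive.\<close>
  define b where "b n x = a (SOME e. e \<in> E n \<and> dist x e < q n)" for n x
  have b: "b n x = a e" if "e \<in> E n" "dist x e < q n" for n x e
  proof -
    define e' where "e' = (SOME e. e \<in> E n \<and> dist x e < q n)"
    have "e' \<in> E n \<and> dist x e' < q n" unfolding e'_def by (rule someI) (use that in blast)
    then have "a e' = a e"
      using that dist_triangle[of e' e x] by (intro sep) (auto simp: dist_commute)
    then show ?thesis by (simp add: b_def e'_def)
  qed
  have bb: "norm (b n x) \<le> 1 \<and> x \<in> C (b n x)" if px: "p n x > 0" for n x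
  proof -
    obtain e where e: "e \<in> E n" "dist x e < q n" using near[OF px] by blast
    have "A e \<noteq> 0" "x \<in> ball e (2 * q n)" using e q0[of n] by (auto simp: E_def dist_commute)
    then have "norm (a e) \<le> 1" "x \<in> C (a e)" using a(1) e(1) by (auto simp: E_def)
    then show ?thesis using b[OF e] by simp
  qed
  define g where "g n x = p n x *\<^sub>R b n x" for n x
  have normg: "norm (g n x) \<le> p n x" for n x
    using bb[of n x] p0[of n x] mult_left_le[of "norm (b n x)" "p n x"]
    by (cases "p n x > 0") (auto simp: g_def)
  have contg: "continuous_on UNIV (g n)" for n
  proof -
    have "isCont (g n) x" for x
    proof (cases "p n x > 0")
      case True
      then obtain e where e: "e \<in> E n" "dist x e < q n" using near by blast
      have "\<forall>\<^sub>F y in nhds x. y \<in> {y. dist y e < q n}"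
        using e(2) by (intro eventually_nhds_in_open open_Collect_less continuous_intros) simp
      then have ev: "\<forall>\<^sub>F y in nhds x. g n y = p n y *\<^sub>R a e"
        by eventually_elim (simp add: g_def b[OF e(1)])
      have "isCont (\<lambda>y. p n y *\<^sub>R a e) x"
        by (intro continuous_intros) (use contp[of UNIV n] continuous_on_eq_continuous_at in blast)
      then show ?thesis using isCont_cong[OF ev] by simp
    next
      case False
      \<comment> \<open>At a zero of \<open>p n\<close> the direction may jump, but
        \<open>normg\<close> squeezes \<open>g n\<close> to 0.\<close>
      then have p: "p n x = 0" using p0[of n x] by simp
      have "isCont (p n) x" using contp[of UNIV n] continuous_on_eq_continuous_at by blast
      then have "(p n \<longlongrightarrow> 0) (at x)" using p by (simp add: isCont_def)
      then have "(g n \<longlongrightarrow> 0) (at x)"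
        by (rule Lim_null_comparison[rotated]) (simp add: normg)
      then show ?thesis using p by (simp add: isCont_def g_def)
    qed
    then show ?thesis by (simp add: continuous_at_imp_continuous_on)
  qed
  have sumq: "summable q" unfolding q_def by (rule summable_geometric) simp
  have sump: "summable (\<lambda>n. p n x)" for x
    by (rule summable_comparison_test'[OF sumq]) (use p0 pq in auto)
  have sumg: "summable (\<lambda>n. g n x)" for x
    by (rule summable_comparison_test'[OF sumq]) (meson normg pq order_trans)
  define P where "P x = (\<Sum>n. p n x)" for x
  define G where "G x = (\<Sum>n. g n x)" for x
  have contG: "continuous_on UNIV G"
  proof -
    have "uniform_limit UNIV (\<lambda>n x. \<Sum>i<n. g i x) (\<lambda>x. \<Sum>i. g i x) sequentially"
      by (rule Weierstrass_m_test[OF _ sumq]) (meson normg pq order_trans)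
    then show ?thesis unfolding G_def
      by (rule uniform_limit_theorem[rotated]) (simp, intro always_eventually allI continuous_on_sum contg)
  qed
  \<comment> \<open>The open set \<open>C (a x)\<close> contains a ball around \<open>x\<close>, so
    \<open>x\<close> lies in \<open>E n\<close> at a fine enough scale and gets the full weight
    \<open>q n\<close> there.\<close>
  have Ppos: "P x > 0" if x: "A x \<noteq> 0" for x
  proof -
    obtain e where e: "e > 0" "ball x e \<subseteq> C (a x)"
      using a(2)[OF x] openC open_contains_ball by blast
    obtain n where "(1/2) ^ n < e / 2" using real_arch_pow_inv[of "e/2" "1/2"] e by auto
    then have "ball x (2 * q n) \<subseteq> ball x e" by (auto simp: q_def)
    then have "x \<in> E n" using x e by (auto simp: E_def)
    then have "p n x = q n" using q0[of n] by (auto simp: p_def less_imp_le)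
    then show ?thesis unfolding P_def
      using q0[of n] by (intro suminf_pos2[OF sump p0, where i = n]) auto
  qed
  have AG: "norm (A x) / 2 * P x \<le> blinfun_apply (A x) (G x)" for x
  proof -
    have "norm (A x) / 2 * p n x \<le> blinfun_apply (A x) (g n x)" for n
      using bb[of n x] p0[of n x] unfolding C_def g_def
      by (cases "p n x > 0") (auto simp: blinfun.scaleR_right mult.commute)
    then have "(\<Sum>n. norm (A x) / 2 * p n x) \<le> (\<Sum>n. blinfun_apply (A x) (g n x))"
      using sump sumg by (intro suminf_le summable_mult bounded_linear.summable[OF blinfun.bounded_linear_right])
    also have "\<dots> = blinfun_apply (A x) (G x)"
      unfolding G_def by (rule bounded_linear.suminf[OF blinfun.bounded_linear_right sumg, symmetric])
    finally show ?thesis unfolding P_def using suminf_mult[OF sump[of x], of "norm (A x) / 2"] by simp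
  qed
  have Gpos: "blinfun_apply (A x) (G x) > 0" if "A x \<noteq> 0" for x
    by (rule less_le_trans[OF _ AG]) (use Ppos that in auto)
  have normG: "norm (G x) \<le> P x" for x
    unfolding G_def P_def by (rule norm_suminf_le[OF normg sump])
  show thesis
  \<comment> \<open>The total weight cancels: \<open>norm (G x)\<close> is at most
    \<open>P x\<close>, while the pairing is at least \<open>norm (A x) / 2 * P x\<close>.\<close>
  proof (rule that[of "\<lambda>x. G x /\<^sub>R blinfun_apply (A x) (G x)"])
    show "continuous_on {x. A x \<noteq> 0} (\<lambda>x. G x /\<^sub>R blinfun_apply (A x) (G x))"
      using Gpos by (intro continuous_intros continuous_on_subset[OF contG] continuous_on_subset[OF contA])
        (auto simp: less_le)
    fix x assume x: "A x \<noteq> 0"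
    show "blinfun_apply (A x) (G x /\<^sub>R blinfun_apply (A x) (G x)) = 1"
      using Gpos[OF x] by (simp add: blinfun.scaleR_right)
    have "norm (A x) * norm (G x) \<le> norm (A x) * P x" using normG by (intro mult_left_mono) auto
    also have "\<dots> \<le> 2 * blinfun_apply (A x) (G x)" using AG[of x] by simp
    finally show "norm (G x /\<^sub>R blinfun_apply (A x) (G x)) \<le> 2 / norm (A x)"
      using Gpos[OF x] x by (simp add: field_simps)
  qed
qed

section \<open>Euler steps along a continuous field\<close>

text \<open>Near \<open>(x, 0)\<close> the derivative of \<phi> along the field stays within
  \<kappa> of 1, so the mean value inequality bounds the error of a step. Continuity of
  \<open>s\<close> lets the iterates depend continuously on the starting point.\<close>

lemma step_size:
  fixes \<phi> :: "'x::real_normed_vector \<Rightarrow> real" and \<phi>' :: "'x \<Rightarrow> 'x \<Rightarrow>\<^sub>L real"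
  assumes der: "\<And>x. (\<phi> has_derivative blinfun_apply (\<phi>' x)) (at x)"
    and cont: "continuous_on UNIV \<phi>'" and "open U" and w: "continuous_on U w"
    and unit: "\<And>x. x \<in> U \<Longrightarrow> blinfun_apply (\<phi>' x) (w x) = 1" and "\<kappa> > 0"
  obtains s where "continuous_on UNIV s" "\<And>x. x \<in> U \<Longrightarrow> s x > 0"
    "\<And>x h. x \<in> U \<Longrightarrow> 0 \<le> h \<Longrightarrow> h \<le> s x \<Longrightarrow> \<bar>\<phi> (x - h *\<^sub>R w x) - \<phi> x + h\<bar> \<le> \<kappa> * h"
proof -
  define B where "B = {(y, h). \<not> (\<bar>h\<bar> < 1 \<and> \<bar>\<phi> (y - h *\<^sub>R w y) - \<phi> y + h\<bar> \<le> \<kappa> * \<bar>h\<bar>)}"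
  have "(undefined, 1) \<in> B" by (simp add: B_def)
  then have Bne: "B \<noteq> {}" by blast
  text \<open>Half the distance from \<open>(x, 0)\<close> to the bad pairs is a continuous admissible step size; the
    clause \<open>\<bar>h\<bar> < 1\<close> only ensures that there are bad pairs, as \<open>infdist\<close> to the empty set is \<open>0\<close>.\<close>
  define s where "s x = infdist (x, 0::real) B / 2" for x
  have pos: "s x > 0" if "x \<in> U" for x
  proof -
    define G where "G z = blinfun_apply (\<phi>' (fst z - snd z *\<^sub>R w (fst z))) (w (fst z))" for z :: "'x \<times> real"
    have "continuous_on (U \<times> UNIV) G"
      unfolding G_def
      by (intro continuous_intros continuous_on_compose2[OF cont] continuous_on_compose2[OF w]) auto
    moreover have "open (U \<times> (UNIV::real set))" using \<open>open U\<close> by (intro open_Times) auto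
    ultimately have "isCont G (x, 0)" using that by (simp add: continuous_on_eq_continuous_at)
    moreover have "G (x, 0) = 1" using unit that by (simp add: G_def)
    ultimately obtain d1 where d1: "d1 > 0" "\<And>z. dist z (x, 0) < d1 \<Longrightarrow> dist (G z) 1 < \<kappa>"
      using \<open>\<kappa> > 0\<close> unfolding continuous_at_eps_delta by metis
    \<comment> \<open>Points \<open>(y, k)\<close> with both components within \<open>d\<close> are
      at distance below \<open>2 * d\<close>, hence below \<open>d1\<close>; the cap keeps
      \<bar>h\<bar> below 1.\<close>
    define d where "d = min d1 1 / 2"
    have d: "d > 0" "2 * d \<le> d1" "d < 1" using d1(1) by (auto simp: d_def)
    have "z \<notin> B" if z: "dist z (x, 0) < d" for z
    proof -
      obtain y h where zy: "z = (y, h)" by force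
      have y: "dist y x < d" and h: "\<bar>h\<bar> < d"
        using z dist_fst_le[of z "(x, 0)"] dist_snd_le[of z "(x, 0)"] by (auto simp: zy)
      define f where "f k = \<phi> (y - k *\<^sub>R w y) + k" for k
      have derf: "(f has_real_derivative (1 - G (y, k))) (at k)" for k
      proof -
        have 1: "((\<lambda>k. y - k *\<^sub>R w y) has_derivative (\<lambda>t. - (t *\<^sub>R w y))) (at k)"
          by (auto intro!: derivative_eq_intros)
        have 2: "(\<phi> has_derivative blinfun_apply (\<phi>' (y - k *\<^sub>R w y))) (at (y - k *\<^sub>R w y))"
          by (rule der)
        have "(f has_derivative (\<lambda>t. blinfun_apply (\<phi>' (y - k *\<^sub>R w y)) (- (t *\<^sub>R w y)) + t)) (at k)"
          unfolding f_def
          by (intro has_derivative_add has_derivative_ident) (rule has_derivative_compose[OF 1 2])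
        then show ?thesis
          by (rule has_derivative_imp_has_field_derivative)
            (simp add: G_def blinfun.minus_right blinfun.scaleR_right algebra_simps)
      qed
      have bound: "norm (1 - G (y, k)) \<le> \<kappa>" if "k \<in> {-d<..<d}" for k
      proof -
        have "dist (y, k) (x, 0) \<le> dist y x + \<bar>k\<bar>"
          unfolding dist_prod_def using sqrt_sum_squares_le_sum_abs[of "dist y x" k] by simp
        also have "\<dots> < d1" using y that d by auto
        finally show ?thesis using d1(2) by (simp add: dist_real_def abs_minus_commute less_imp_le)
      qed
      have "norm (f h - f 0) \<le> \<kappa> * norm (h - 0)"
        by (rule field_differentiable_bound[of "{-d<..<d}", OF _ has_field_derivative_at_within[OF derf] bound])
          (use h d in auto)
      then show ?thesis using h d by (simp add: B_def zy f_def algebra_simps)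
    qed
    then have "d \<le> infdist (x, 0) B"
      unfolding infdist_notempty[OF Bne]
      by (intro cINF_greatest[OF Bne]) (metis dist_commute linorder_not_less)
    then show ?thesis using d by (simp add: s_def)
  qed
  show thesis
  proof (rule that[of s])
    show "continuous_on UNIV s" unfolding s_def by (intro continuous_intros) auto
    show "s x > 0" if "x \<in> U" for x by (rule pos[OF that])
    fix x h assume x: "x \<in> U" "0 \<le> h" "h \<le> s x"
    have "(x, h) \<notin> B"
    proof
      assume "(x, h) \<in> B"
      then have "2 * s x \<le> dist (x, 0) (x, h)" unfolding s_def using infdist_le by force
      also have "\<dots> = h" using x by (simp add: dist_prod_def dist_real_def)
      finally show False using x pos[OF x(1)] by simp
    qed
    then show "\<bar>\<phi> (x - h *\<^sub>R w x) - \<phi> x + h\<bar> \<le> \<kappa> * h" using x by (simp add: B_def)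
  qed
qed


text \<open>Each point gets a time budget \<open>T x\<close>. Spent time bounds displacement and
  controls the drop of \<phi> from both sides, so \<open>reach\<close> keeps the iterates where the
  field is defined and bounded by \<open>C\<close>. As \<open>reach\<close> concerns all points
  \<open>y\<close> within these closed bounds, it also applies to limits of iterates.\<close>

lemma euler_deformation:
  fixes \<phi> :: "'x::banach \<Rightarrow> real"
  assumes "open U" and w: "continuous_on U w" and s: "continuous_on UNIV s" "\<And>x. x \<in> U \<Longrightarrow> s x > 0"
    and \<phi>: "continuous_on UNIV \<phi>"
    and step: "\<And>x h. x \<in> U \<Longrightarrow> 0 \<le> h \<Longrightarrow> h \<le> s x \<Longrightarrow>
      \<bar>\<phi> (x - h *\<^sub>R w x) - \<phi> x + h\<bar> \<le> \<kappa> * h"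
    and \<kappa>: "0 \<le> \<kappa>" "\<kappa> \<le> 1" and "C \<ge> 0"
    and T: "continuous_on Y T" "\<And>x. x \<in> Y \<Longrightarrow> T x \<ge> 0"
    and reach: "\<And>x y. x \<in> Y \<Longrightarrow> T x > 0 \<Longrightarrow> dist y x \<le> C * T x \<Longrightarrow> \<phi> y \<le> \<phi> x \<Longrightarrow>
      \<phi> x - (1 + \<kappa>) * T x \<le> \<phi> y \<Longrightarrow> y \<in> U \<and> norm (w y) \<le> C"
  obtains \<eta> where "continuous_on Y \<eta>" "\<And>x. x \<in> Y \<Longrightarrow> dist (\<eta> x) x \<le> C * T x"
    "\<And>x. x \<in> Y \<Longrightarrow> \<phi> (\<eta> x) \<le> \<phi> x - (1 - \<kappa>) * T x"
proof -
  \<comment> \<open>The state is a point with its remaining time. Capping the step by that time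
    makes a state with empty budget stationary, provided \<open>s\<close> is positive there.\<close>
  define F where "F z = (fst z - min (snd z) (s (fst z)) *\<^sub>R w (fst z), snd z - min (snd z) (s (fst z)))"
    for z :: "'x \<times> real"
  define z where "z n x = (F ^^ n) (x, T x)" for n x
  have z_Suc: "z (Suc n) x = F (z n x)" for n x by (simp add: z_def)
  have z_0: "z 0 x = (x, T x)" for x by (simp add: z_def)
  define D where "D = {x \<in> Y. T x > 0}"
  have inU: "fst (z n x) \<in> U \<and> norm (w (fst (z n x))) \<le> C" and r0: "snd (z n x) \<ge> 0" "snd (z n x) \<le> T x"
    and dist_z: "dist (fst (z n x)) x \<le> C * (T x - snd (z n x))"
    and \<phi>_up: "\<phi> (fst (z n x)) \<le> \<phi> x - (1 - \<kappa>) * (T x - snd (z n x))"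
    and \<phi>_lo: "\<phi> x - (1 + \<kappa>) * (T x - snd (z n x)) \<le> \<phi> (fst (z n x))"
    if x: "x \<in> D" for n x
  proof -
    have *: "y \<in> U \<and> norm (w y) \<le> C"
      if "0 \<le> r" "r \<le> T x" "dist y x \<le> C * (T x - r)" "\<phi> y \<le> \<phi> x - (1 - \<kappa>) * (T x - r)"
        "\<phi> x - (1 + \<kappa>) * (T x - r) \<le> \<phi> y" for y r
    proof (rule reach)
      show "x \<in> Y" "T x > 0" using x by (auto simp: D_def)
      have "C * (T x - r) \<le> C * T x" "(1 + \<kappa>) * (T x - r) \<le> (1 + \<kappa>) * T x"
        using that \<open>C \<ge> 0\<close> \<kappa> by (auto intro!: mult_left_mono)
      then show "dist y x \<le> C * T x" "\<phi> x - (1 + \<kappa>) * T x \<le> \<phi> y" using that by auto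
      have "0 \<le> (1 - \<kappa>) * (T x - r)" using that \<kappa> by (intro mult_nonneg_nonneg) auto
      then show "\<phi> y \<le> \<phi> x" using that by auto
    qed
    have inv: "0 \<le> snd (z n x) \<and> snd (z n x) \<le> T x \<and> dist (fst (z n x)) x \<le> C * (T x - snd (z n x)) \<and>
      \<phi> (fst (z n x)) \<le> \<phi> x - (1 - \<kappa>) * (T x - snd (z n x)) \<and>
      \<phi> x - (1 + \<kappa>) * (T x - snd (z n x)) \<le> \<phi> (fst (z n x))"
    proof (induction n)
      case 0
      then show ?case using x by (simp add: z_0 D_def)
    next
      case (Suc n)
      obtain y r where yr: "z n x = (y, r)" by force
      note IH = Suc.IH[unfolded yr fst_conv snd_conv]
      have y: "y \<in> U" "norm (w y) \<le> C" using *[of r y] IH by auto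
      define h where "h = min r (s y)"
      have h: "0 \<le> h" "h \<le> r" "h \<le> s y" using IH s(2)[OF y(1)] by (auto simp: h_def)
      have "dist (y - h *\<^sub>R w y) x \<le> dist (y - h *\<^sub>R w y) y + dist y x" by (rule dist_triangle)
      moreover have "dist (y - h *\<^sub>R w y) y \<le> C * h"
        using h(1) mult_right_mono[OF y(2) h(1)] by (simp add: dist_norm mult.commute)
      ultimately have "dist (y - h *\<^sub>R w y) x \<le> C * (T x - (r - h))" using IH by (simp add: algebra_simps)
      moreover have "\<bar>\<phi> (y - h *\<^sub>R w y) - \<phi> y + h\<bar> \<le> \<kappa> * h" using step y h by blast
      ultimately show ?case using IH h
        by (simp add: z_Suc F_def yr h_def[symmetric] abs_le_iff algebra_simps)
    qed
    then show "fst (z n x) \<in> U \<and> norm (w (fst (z n x))) \<le> C" using * by blast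
    show "snd (z n x) \<ge> 0" "snd (z n x) \<le> T x" "dist (fst (z n x)) x \<le> C * (T x - snd (z n x))"
      "\<phi> (fst (z n x)) \<le> \<phi> x - (1 - \<kappa>) * (T x - snd (z n x))"
      "\<phi> x - (1 + \<kappa>) * (T x - snd (z n x)) \<le> \<phi> (fst (z n x))"
      using inv by auto
  qed
  have contz: "continuous_on D (z n)" for n
  proof (induction n)
    case 0
    then show ?case unfolding z_0 by (intro continuous_intros continuous_on_subset[OF T(1)]) (auto simp: D_def)
  next
    case (Suc n)
    have "continuous_on D (\<lambda>x. w (fst (z n x)))" "continuous_on D (\<lambda>x. s (fst (z n x)))"
      by (rule continuous_on_compose2[OF w] continuous_on_compose2[OF s(1)],
          use inU in \<open>auto intro!: continuous_intros Suc.IH\<close>)+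
    then show ?case unfolding z_Suc F_def by (intro continuous_intros Suc.IH)
  qed
  have stays: "z m x = z n x" if "snd (z n x) = 0" "x \<in> D" "n \<le> m" for n m x
    using that(3)
  proof (induction m rule: dec_induct)
    case (step m)
    then show ?case using that inU[of x m] s(2)[of "fst (z m x)"] by (simp add: z_Suc F_def prod_eq_iff)
  qed simp
  text \<open>If the budget \<open>snd (z n x)\<close> never ran out, every step would be a full step \<open>s\<close>; the iterates
    would converge to a point of \<open>U\<close> at which \<open>s\<close> vanishes.\<close>
  have stops: "\<exists>n. snd (z n x) = 0" if x: "x \<in> D" for x
  proof (rule ccontr)
    assume never: "\<nexists>n. snd (z n x) = 0"
    define X where "X n = fst (z n x)" for n
    define r where "r n = snd (z n x)" for n
    have full: "min (r n) (s (X n)) = s (X n)" for n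
    proof (rule ccontr)
      assume "min (r n) (s (X n)) \<noteq> s (X n)"
      then have "snd (z (Suc n) x) = 0" by (auto simp: z_Suc F_def r_def X_def min_def split: if_splits)
      with never show False by blast
    qed
    have X_Suc: "X (Suc n) = X n - s (X n) *\<^sub>R w (X n)" and r_Suc: "r (Suc n) = r n - s (X n)" for n
      using full[of n] by (simp_all add: X_def r_def z_Suc F_def)
    have XU: "X n \<in> U" "norm (w (X n)) \<le> C" for n using inU[OF x] by (auto simp: X_def)
    have sX: "s (X n) \<ge> 0" for n using s(2)[OF XU(1)[of n]] by simp
    have "decseq r" by (rule decseq_SucI) (simp add: r_Suc sX)
    moreover have "0 \<le> r n" for n using r0(1)[OF x] by (simp add: r_def)
    ultimately obtain l where l: "r \<longlonglongrightarrow> l" using decseq_convergent by metis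
    have "(\<lambda>n. r n - r (Suc n)) \<longlonglongrightarrow> l - l" by (intro tendsto_diff LIMSEQ_Suc l)
    then have s_lim: "(\<lambda>n. s (X n)) \<longlonglongrightarrow> 0" by (simp add: r_Suc)
    \<comment> \<open>The step sizes telescope to the spent time, which is bounded; the increments
      are then absolutely summable, and completeness gives a limit.\<close>
    have "summable (\<lambda>n. r n - r (Suc n))" using telescope_sums'[OF l] by (simp add: sums_iff)
    then have sum_s: "summable (\<lambda>n. C * s (X n))" by (intro summable_mult) (simp add: r_Suc)
    have "norm (X (Suc n) - X n) \<le> C * s (X n)" for n
      using mult_right_mono[OF XU(2)[of n] sX[of n]] sX[of n] by (simp add: X_Suc mult.commute)
    then have "summable (\<lambda>n. X (Suc n) - X n)" by (intro summable_comparison_test'[OF sum_s])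
    then have "convergent (\<lambda>n. \<Sum>i<n. X (Suc i) - X i)" by (simp add: summable_iff_convergent)
    then obtain L where "(\<lambda>n. \<Sum>i<n. X (Suc i) - X i) \<longlonglongrightarrow> L" by (auto simp: convergent_def)
    then have "(\<lambda>n. X n - X 0) \<longlonglongrightarrow> L" by (simp add: sum_lessThan_telescope)
    then have "(\<lambda>n. (X n - X 0) + X 0) \<longlonglongrightarrow> L + X 0" by (intro tendsto_intros)
    then have lim: "X \<longlonglongrightarrow> L + X 0" by simp
    have phi_lim: "(\<lambda>n. \<phi> (X n)) \<longlonglongrightarrow> \<phi> (L + X 0)"
      by (rule continuous_on_tendsto_compose[OF \<phi> lim]) auto
    have T0: "x \<in> Y" "T x > 0" using x by (auto simp: D_def)
    have drop: "0 \<le> (1 - \<kappa>) * (T x - r n)" "(1 + \<kappa>) * (T x - r n) \<le> (1 + \<kappa>) * T x" "C * (T x - r n) \<le> C * T x" for n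
      using r0[OF x, of n] \<kappa> \<open>C \<ge> 0\<close> by (auto simp: r_def intro!: mult_left_mono)
    have "L + X 0 \<in> U"
    proof (rule reach[OF T0, THEN conjunct1])
      have "dist (X n) x \<le> C * T x" for n using dist_z[OF x, of n] drop[of n] by (simp add: X_def r_def)
      then show "dist (L + X 0) x \<le> C * T x"
        by (intro Lim_bounded[OF tendsto_dist[OF lim tendsto_const]]) auto
      have "\<phi> (X n) \<le> \<phi> x" for n using \<phi>_up[OF x, of n] drop(1)[of n] by (simp add: X_def r_def)
      then show "\<phi> (L + X 0) \<le> \<phi> x" by (intro Lim_bounded[OF phi_lim]) auto
      have "\<phi> x - (1 + \<kappa>) * T x \<le> \<phi> (X n)" for n
        using \<phi>_lo[OF x, of n] drop(2)[of n] by (simp add: X_def r_def)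
      then show "\<phi> x - (1 + \<kappa>) * T x \<le> \<phi> (L + X 0)" by (intro Lim_bounded2[OF phi_lim]) auto
    qed
    moreover have "(\<lambda>n. s (X n)) \<longlonglongrightarrow> s (L + X 0)"
      by (rule continuous_on_tendsto_compose[OF s(1) lim]) auto
    then have "s (L + X 0) = 0" using s_lim LIMSEQ_unique by blast
    ultimately show False using s(2)[of "L + X 0"] by simp
  qed
  define \<eta> where "\<eta> x = (if x \<in> D then fst (z (LEAST n. snd (z n x) = 0) x) else x)" for x
  have \<eta>_eq: "\<eta> x = fst (z n x)" if "x \<in> D" "snd (z n x) = 0" for n x
  proof -
    have "snd (z (LEAST n. snd (z n x) = 0) x) = 0" using that(2) by (rule LeastI)
    then have "z n x = z (LEAST n. snd (z n x) = 0) x" by (rule stays) (use that in \<open>auto intro: Least_le\<close>)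
    then show ?thesis using that by (simp add: \<eta>_def)
  qed
  have dist_\<eta>: "dist (\<eta> x) x \<le> C * T x" and \<phi>_\<eta>: "\<phi> (\<eta> x) \<le> \<phi> x - (1 - \<kappa>) * T x" if x: "x \<in> Y" for x
  proof -
    have "dist (\<eta> x) x \<le> C * T x \<and> \<phi> (\<eta> x) \<le> \<phi> x - (1 - \<kappa>) * T x"
    proof (cases "x \<in> D")
      case True
      then obtain n where "snd (z n x) = 0" using stops by blast
      then show ?thesis using dist_z[OF True, of n] \<phi>_up[OF True, of n] \<eta>_eq[OF True] by simp
    next
      case False
      then have "T x = 0" using x T(2)[OF x] by (simp add: D_def)
      then show ?thesis using False by (simp add: \<eta>_def)
    qed
    then show "dist (\<eta> x) x \<le> C * T x" "\<phi> (\<eta> x) \<le> \<phi> x - (1 - \<kappa>) * T x" by auto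
  qed
  have "continuous_on Y \<eta>"
    unfolding continuous_on_eq_continuous_within
  proof
    fix x assume x: "x \<in> Y"
    show "continuous (at x within Y) \<eta>"
    proof (cases "x \<in> D")
      case True
      then obtain n where n: "snd (z n x) = 0" using stops by blast
      \<comment> \<open>A neighbour of \<open>x\<close> may have time left after \<open>n\<close>
        steps, but less than one full step, so it stops at step \<open>Suc n\<close>. This single
        index serves a whole neighbourhood.\<close>
      have sz: "continuous_on D (\<lambda>y. s (fst (z n y)) - snd (z n y))"
        by (intro continuous_intros contz continuous_on_compose2[OF s(1)]) auto
      have "openin (top_of_set D) (D \<inter> (\<lambda>y. s (fst (z n y)) - snd (z n y)) -` {0<..})"
        by (rule continuous_openin_preimage_gen[OF sz]) simp
      moreover have "openin (top_of_set Y) D"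
      proof -
        have "openin (top_of_set Y) (Y \<inter> T -` {0<..})"
          by (rule continuous_openin_preimage_gen[OF T(1)]) simp
        moreover have "Y \<inter> T -` {0<..} = D" by (auto simp: D_def)
        ultimately show ?thesis by simp
      qed
      ultimately have "openin (top_of_set Y) (D \<inter> (\<lambda>y. s (fst (z n y)) - snd (z n y)) -` {0<..})"
        by (rule openin_trans)
      then obtain V where V: "open V"
        "D \<inter> (\<lambda>y. s (fst (z n y)) - snd (z n y)) -` {0<..} = Y \<inter> V"
        unfolding openin_open by blast
      have xV: "x \<in> Y \<inter> V" unfolding V(2)[symmetric] using True n s(2) inU[OF True, of n] by simp
      have "continuous_on (Y \<inter> V) (\<lambda>y. fst (z (Suc n) y))"
        by (intro continuous_intros continuous_on_subset[OF contz]) (use V(2) in blast)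
      moreover have "\<eta> y = fst (z (Suc n) y)" if y: "y \<in> Y \<inter> V" for y
      proof (rule \<eta>_eq)
        have "y \<in> D" and "snd (z n y) < s (fst (z n y))" using y unfolding V(2)[symmetric] by auto
        then show "y \<in> D" "snd (z (Suc n) y) = 0" by (auto simp: z_Suc F_def)
      qed
      ultimately have "continuous_on (Y \<inter> V) \<eta>"
        using continuous_on_cong[OF refl, of "Y \<inter> V" \<eta> "\<lambda>y. fst (z (Suc n) y)"] by blast
      then have "continuous (at x within Y \<inter> V) \<eta>" using xV by (simp add: continuous_on_eq_continuous_within)
      moreover have "at x within Y \<inter> V = at x within Y"
        by (rule at_within_nhd[of _ V]) (use V(1) xV in auto)
      ultimately show ?thesis by simp
    next
      case False
      \<comment> \<open>\<open>reach\<close> gives no information where the budget vanishes;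
        continuity there comes from the displacement bound \<open>C * T y\<close>, which tends to
        0.\<close>
      then have T0: "T x = 0" and \<eta>x: "\<eta> x = x" using x T(2)[OF x] by (auto simp: D_def \<eta>_def)
      have "(T \<longlongrightarrow> 0) (at x within Y)" using T(1) x T0 by (force simp: continuous_on_def)
      then have "((\<lambda>y. C * T y) \<longlongrightarrow> C * 0) (at x within Y)" by (intro tendsto_intros)
      then have lim: "((\<lambda>y. C * T y) \<longlongrightarrow> 0) (at x within Y)" by simp
      have "\<forall>\<^sub>F y in at x within Y. norm (\<eta> y - y) \<le> C * T y"
        unfolding eventually_at_filter using dist_\<eta> by (simp add: dist_norm)
      then have "((\<lambda>y. \<eta> y - y) \<longlongrightarrow> 0) (at x within Y)" using lim by (rule Lim_null_comparison)
      then have "((\<lambda>y. (\<eta> y - y) + y) \<longlongrightarrow> 0 + x) (at x within Y)" by (intro tendsto_intros)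
      then show ?thesis by (simp add: continuous_within \<eta>x)
    qed
  qed
  then show thesis using dist_\<eta> \<phi>_\<eta> that by blast
qed

section \<open>Deformation away from almost critical points\<close>

text \<open>In the level band but off \<open>K\<close> the derivative has norm at least
  8\<epsilon>/\<delta>, so the field has norm at most \<delta>/(4\<epsilon>). Running it for time at
  most 16\<epsilon>/7, below 4\<epsilon>, moves points by at most \<delta>.\<close>

lemma quantitative_deformation:
  fixes \<phi> :: "'x::banach \<Rightarrow> real" and \<phi>' :: "'x \<Rightarrow> 'x \<Rightarrow>\<^sub>L real" and c \<epsilon> \<delta> :: real
  assumes der: "\<And>x. (\<phi> has_derivative blinfun_apply (\<phi>' x)) (at x)"
    and cont: "continuous_on UNIV \<phi>'" and "\<epsilon> > 0" "\<delta> > 0"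
  defines "K \<equiv> {x. c - 2 * \<epsilon> \<le> \<phi> x \<and> \<phi> x \<le> c + 2 * \<epsilon> \<and> norm (\<phi>' x) < 8 * \<epsilon> / \<delta>}"
  obtains \<eta> where "continuous_on {x. \<phi> x \<le> c + \<epsilon>} \<eta>"
    "\<And>x. \<phi> x \<le> c + \<epsilon> \<Longrightarrow> dist (\<eta> x) x \<le> \<delta>"
    "\<And>x. \<phi> x \<le> c + \<epsilon> \<Longrightarrow> \<phi> (\<eta> x) \<le> \<phi> x"
    "\<And>x. \<phi> x \<le> c - \<epsilon> \<Longrightarrow> \<eta> x = x"
    "\<And>x. \<phi> x \<le> c + \<epsilon> \<Longrightarrow> (\<And>k. k \<in> K \<Longrightarrow> dist k x > 2 * \<delta>) \<Longrightarrow> \<phi> (\<eta> x) \<le> c - \<epsilon>"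
proof -
  obtain w where w: "continuous_on {x. \<phi>' x \<noteq> 0} w"
    "\<And>x. \<phi>' x \<noteq> 0 \<Longrightarrow> blinfun_apply (\<phi>' x) (w x) = 1"
    "\<And>x. \<phi>' x \<noteq> 0 \<Longrightarrow> norm (w x) \<le> 2 / norm (\<phi>' x)"
    using pseudo_gradient[OF cont] by metis
  have openU: "open {x. \<phi>' x \<noteq> 0}" by (intro open_Collect_neq continuous_intros cont)
  have unit: "blinfun_apply (\<phi>' x) (w x) = 1" if "x \<in> {x. \<phi>' x \<noteq> 0}" for x using w(2) that by simp
  \<comment> \<open>Any tolerance \<kappa> up to 1/5 is small enough: then (1 + \<kappa>)/(1 -
    \<kappa>) * 2\<epsilon> is at most 3\<epsilon>, so a descent started at level c + \<epsilon>
    stays above c - 2\<epsilon>.\<close>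
  obtain s where s: "continuous_on UNIV s" "\<And>x. x \<in> {x. \<phi>' x \<noteq> 0} \<Longrightarrow> s x > 0"
    "\<And>x h. x \<in> {x. \<phi>' x \<noteq> 0} \<Longrightarrow> 0 \<le> h \<Longrightarrow> h \<le> s x \<Longrightarrow> \<bar>\<phi> (x - h *\<^sub>R w x) - \<phi> x + h\<bar> \<le> 1/8 * h"
    by (rule step_size[OF der cont openU w(1) unit, of "1/8"]) (assumption, simp, rule that)
  have cont\<phi>: "continuous_on UNIV \<phi>"
    by (intro continuous_at_imp_continuous_on ballI has_derivative_continuous[OF der])
  \<comment> \<open>The cut-off is 0 within \<delta> of \<open>K\<close> and 1 from distance
    2\<delta> on. The case of empty \<open>K\<close> is separate because \<open>infdist\<close>
    would be 0 and switch the deformation off.\<close>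
  define \<theta> where "\<theta> x = (if K = {} then 1 else min 1 (max 0 (infdist x K / \<delta> - 1)))" for x
  have cont\<theta>: "continuous_on S \<theta>" for S
    unfolding \<theta>_def using \<open>\<delta> > 0\<close> by (cases "K = {}") (auto intro!: continuous_intros)
  have \<theta>: "0 \<le> \<theta> x" "\<theta> x \<le> 1" for x by (auto simp: \<theta>_def)
  have \<theta>_pos: "dist k x > \<delta>" if "\<theta> x > 0" "k \<in> K" for x k
    using that infdist_le[OF that(2), of x] \<open>\<delta> > 0\<close>
    by (auto simp: \<theta>_def field_simps dist_commute split: if_splits)
  have \<theta>_1: "\<theta> x = 1" if "\<And>k. k \<in> K \<Longrightarrow> dist k x > 2 * \<delta>" for x
  proof (cases "K = {}")
    case False
    then have "2 * \<delta> \<le> infdist x K"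
      unfolding infdist_notempty[OF False]
      by (intro cINF_greatest) (use that in \<open>auto simp: dist_commute less_imp_le\<close>)
    then show ?thesis using \<open>\<delta> > 0\<close> by (simp add: \<theta>_def field_simps)
  qed (simp add: \<theta>_def)
  text \<open>Time \<open>T x\<close> costs between \<open>7/8 T x\<close> and \<open>9/8 T x\<close> in level: enough to descend to \<open>c - \<epsilon>\<close>,
    too little to leave the level range of \<open>K\<close>.\<close>
  define T where "T x = 8/7 * max 0 (\<phi> x - (c - \<epsilon>)) * \<theta> x" for x
  have T_le: "T x \<le> 8/7 * max 0 (\<phi> x - (c - \<epsilon>))" for x
    unfolding T_def by (intro mult_left_le \<theta>) auto
  have T_bound: "\<delta> / (4 * \<epsilon>) * T x \<le> \<delta>" if "\<phi> x \<le> c + \<epsilon>" for x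
  proof -
    have "T x \<le> 4 * \<epsilon>" using T_le[of x] that \<open>\<epsilon> > 0\<close> by (auto simp: max_def split: if_splits)
    then show ?thesis using \<open>\<epsilon> > 0\<close> \<open>\<delta> > 0\<close> by (simp add: field_simps)
  qed
  obtain \<eta> where \<eta>: "continuous_on {x. \<phi> x \<le> c + \<epsilon>} \<eta>"
    "\<And>x. x \<in> {x. \<phi> x \<le> c + \<epsilon>} \<Longrightarrow> dist (\<eta> x) x \<le> \<delta> / (4 * \<epsilon>) * T x"
    "\<And>x. x \<in> {x. \<phi> x \<le> c + \<epsilon>} \<Longrightarrow> \<phi> (\<eta> x) \<le> \<phi> x - (1 - 1/8) * T x"
  proof (rule euler_deformation[OF openU w(1) s(1) s(2) cont\<phi> s(3), where T = T and C = "\<delta> / (4 * \<epsilon>)"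
        and Y = "{x. \<phi> x \<le> c + \<epsilon>}"])
    show "continuous_on {x. \<phi> x \<le> c + \<epsilon>} T" unfolding T_def
      by (intro continuous_intros cont\<theta> continuous_on_subset[OF cont\<phi>]) auto
    show "T x \<ge> 0" for x unfolding T_def using \<theta>[of x] by simp
    show "\<delta> / (4 * \<epsilon>) \<ge> 0" using \<open>\<epsilon> > 0\<close> \<open>\<delta> > 0\<close> by simp
    fix x y assume x: "x \<in> {x. \<phi> x \<le> c + \<epsilon>}" "T x > 0" and y: "dist y x \<le> \<delta> / (4 * \<epsilon>) * T x"
      "\<phi> y \<le> \<phi> x" "\<phi> x - (1 + 1/8) * T x \<le> \<phi> y"
    have "\<phi> x > c - \<epsilon>" "\<theta> x > 0"
      using x(2) \<theta>[of x] by (auto simp: T_def max_def zero_less_mult_iff split: if_splits)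
    \<comment> \<open>A moving point starts farther than \<delta> from \<open>K\<close> and travels
      at most \<delta>, so it cannot meet \<open>K\<close>.\<close>
    have "y \<notin> K" using \<theta>_pos[OF \<open>\<theta> x > 0\<close>, of y] T_bound[of x] x y by auto
    moreover have "c - 2 * \<epsilon> \<le> \<phi> y" "\<phi> y \<le> c + 2 * \<epsilon>"
      using T_le[of x] y x \<open>\<phi> x > c - \<epsilon>\<close> \<open>\<epsilon> > 0\<close> by (auto simp: max_def)
    ultimately have n: "8 * \<epsilon> / \<delta> \<le> norm (\<phi>' y)" by (auto simp: K_def)
    moreover have p: "8 * \<epsilon> / \<delta> > 0" using \<open>\<epsilon> > 0\<close> \<open>\<delta> > 0\<close> by simp
    ultimately have ne: "\<phi>' y \<noteq> 0" by auto
    have "norm (w y) \<le> 2 / norm (\<phi>' y)" by (rule w(3)[OF ne])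
    also have "\<dots> \<le> 2 / (8 * \<epsilon> / \<delta>)" using n p ne by (intro divide_left_mono mult_pos_pos) auto
    finally show "y \<in> {x. \<phi>' x \<noteq> 0} \<and> norm (w y) \<le> \<delta> / (4 * \<epsilon>)" using ne by simp
  qed auto
  have T_nonneg: "T x \<ge> 0" for x unfolding T_def using \<theta>[of x] by simp
  show thesis
  proof (rule that[OF \<eta>(1)])
    fix x
    show "dist (\<eta> x) x \<le> \<delta>" if "\<phi> x \<le> c + \<epsilon>" using \<eta>(2)[of x] T_bound[OF that] that by simp
    show "\<phi> (\<eta> x) \<le> \<phi> x" if "\<phi> x \<le> c + \<epsilon>" using \<eta>(3)[of x] T_nonneg[of x] that by simp
    show "\<eta> x = x" if "\<phi> x \<le> c - \<epsilon>"
      using \<eta>(2)[of x] that \<open>\<epsilon> > 0\<close> by (simp add: T_def max_def split: if_splits)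
    show "\<phi> (\<eta> x) \<le> c - \<epsilon>" if "\<phi> x \<le> c + \<epsilon>" "\<And>k. k \<in> K \<Longrightarrow> dist k x > 2 * \<delta>"
      using \<eta>(3)[of x] T_nonneg[of x] \<theta>_1[OF that(2)] that(1) by (auto simp: T_def max_def split: if_splits)
  qed
qed

section \<open>Minimax argument\<close>

theorem proposition2p1:
  fixes M0 :: "'m::metric_space set"
    and \<Gamma>0 \<Gamma> :: "('m \<Rightarrow> 'x::banach) set"
    and \<phi> :: "'x \<Rightarrow> real"
    and \<phi>' :: "'x \<Rightarrow> 'x \<Rightarrow>\<^sub>L real"
    and \<Psi> :: "'x \<Rightarrow> 'x"
    and c \<epsilon> \<delta> :: real
    and a :: ereal
    and \<gamma> :: "'m \<Rightarrow> 'x"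
  assumes "\<Gamma>0 \<subseteq> continuous_maps M0 UNIV"
    and "\<Gamma> = extension_class M0 \<Gamma>0"
    and "\<And>x. (\<phi> has_derivative blinfun_apply (\<phi>' x)) (at x)"
    and "continuous_on UNIV \<phi>'"
    and "ereal c = (INF \<gamma>\<in>\<Gamma>. SUP t. ereal (\<phi> (\<gamma> t)))"
    and "a = (SUP \<gamma>\<^sub>0\<in>\<Gamma>0. SUP t\<in>M0. ereal (\<phi> (\<gamma>\<^sub>0 t)))"
    and "ereal c > a"
    and "\<Psi> \<in> continuous_maps UNIV UNIV"
    and "\<And>x. \<phi> (\<Psi> x) \<le> \<phi> x"
    and "\<And>\<gamma>. \<gamma> \<in> \<Gamma> \<Longrightarrow> \<Psi> \<circ> \<gamma> \<in> \<Gamma>"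
    and "0 < \<epsilon>" and "ereal \<epsilon> < (ereal c - a) / 2"
    and "0 < \<delta>"
    and "\<gamma> \<in> \<Gamma>"
    and "(SUP t. ereal (\<phi> (\<gamma> t))) \<le> ereal (c + \<epsilon>)"
  shows "\<exists>u v w :: 'x.
      c - 2 * \<epsilon> \<le> \<phi> u \<and> \<phi> u \<le> c + 2 * \<epsilon> \<and>
      c - 2 * \<epsilon> \<le> \<phi> v \<and> \<phi> v \<le> c + 2 * \<epsilon> \<and>
      norm (u - w) \<le> 3 * \<delta> \<and>
      infdist w (range \<gamma>) \<le> \<delta> \<and>
      norm (v - \<Psi> w) \<le> 2 * \<delta> \<and>
      norm (\<phi>' u) < 8 * \<epsilon> / \<delta> \<and>
      norm (\<phi>' v) < 8 * \<epsilon> / \<delta>"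
proof -
  define K where "K = {x. c - 2 * \<epsilon> \<le> \<phi> x \<and> \<phi> x \<le> c + 2 * \<epsilon> \<and> norm (\<phi>' x) < 8 * \<epsilon> / \<delta>}"
  obtain \<eta> where \<eta>: "continuous_on {x. \<phi> x \<le> c + \<epsilon>} \<eta>"
    "\<And>x. \<phi> x \<le> c + \<epsilon> \<Longrightarrow> dist (\<eta> x) x \<le> \<delta>"
    "\<And>x. \<phi> x \<le> c + \<epsilon> \<Longrightarrow> \<phi> (\<eta> x) \<le> \<phi> x"
    "\<And>x. \<phi> x \<le> c - \<epsilon> \<Longrightarrow> \<eta> x = x"
    "\<And>x. \<phi> x \<le> c + \<epsilon> \<Longrightarrow> (\<And>k. k \<in> K \<Longrightarrow> dist k x > 2 * \<delta>) \<Longrightarrow> \<phi> (\<eta> x) \<le> c - \<epsilon>"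
    using quantitative_deformation[OF assms(3,4) \<open>0 < \<epsilon>\<close> \<open>0 < \<delta>\<close>, of c, folded K_def] by blast
  \<comment> \<open>The bound on \<epsilon> puts \<open>a\<close> below c - 2\<epsilon>, so \<eta>
    fixes all values on \<open>M0\<close> and composing with it preserves the boundary condition.
    Infinite \<open>a\<close> is contradictory here: it cannot be +\<infinity> by that bound, nor
    -\<infinity> once \<open>M0\<close> has a point \<open>t\<close>.\<close>
  have low: "\<phi> (g t) \<le> c - \<epsilon>" if "g \<in> \<Gamma>" "t \<in> M0" for g t
  proof -
    have "restrict g M0 \<in> \<Gamma>0" using that(1) assms(2) by (simp add: extension_class_def)
    then have "(SUP t\<in>M0. ereal (\<phi> (restrict g M0 t))) \<le> a" unfolding assms(6) by (rule SUP_upper)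
    moreover have "ereal (\<phi> (restrict g M0 t)) \<le> (SUP t\<in>M0. ereal (\<phi> (restrict g M0 t)))"
      using that(2) by (rule SUP_upper)
    ultimately have "ereal (\<phi> (g t)) \<le> a" using that(2) by simp
    with assms(12) \<open>0 < \<epsilon>\<close> show ?thesis by (cases a) auto
  qed
  have comp: "\<eta> \<circ> g \<in> \<Gamma>" if g: "g \<in> \<Gamma>" "\<And>t. \<phi> (g t) \<le> c + \<epsilon>" for g
  proof -
    have "continuous_on UNIV g" "restrict g M0 \<in> \<Gamma>0"
      using g(1) assms(2) by (auto simp: extension_class_def continuous_maps_def)
    moreover have "continuous_on UNIV (\<eta> \<circ> g)"
      unfolding o_def by (rule continuous_on_compose2[OF \<eta>(1) \<open>continuous_on UNIV g\<close>]) (use g(2) in auto)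
    moreover have "restrict (\<eta> \<circ> g) M0 = restrict g M0" using \<eta>(4) low[OF g(1)] by auto
    ultimately show ?thesis using assms(2) by (simp add: extension_class_def continuous_maps_def)
  qed
  have \<gamma>_le: "\<phi> (\<gamma> t) \<le> c + \<epsilon>" for t
    using order_trans[OF SUP_upper[of t UNIV "\<lambda>t. ereal (\<phi> (\<gamma> t))"] assms(15)] by simp
  define \<omega> where "\<omega> = \<eta> \<circ> \<gamma>"
  have \<omega>_le: "\<phi> (\<omega> t) \<le> c + \<epsilon>" for t using \<eta>(3)[OF \<gamma>_le] \<gamma>_le order_trans unfolding \<omega>_def by fastforce
  have \<Psi>_le: "\<phi> (\<Psi> (\<omega> t)) \<le> c + \<epsilon>" for t using assms(9) \<omega>_le order_trans by blast
  have "\<omega> \<in> \<Gamma>" unfolding \<omega>_def by (rule comp) (use assms \<gamma>_le in auto)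
  then have "\<Psi> \<circ> \<omega> \<in> \<Gamma>" by (rule assms(10))
  then have "\<eta> \<circ> (\<Psi> \<circ> \<omega>) \<in> \<Gamma>" by (rule comp) (use \<Psi>_le in auto)
  then have "ereal c \<le> (SUP t. ereal (\<phi> ((\<eta> \<circ> (\<Psi> \<circ> \<omega>)) t)))" unfolding assms(5) by (rule INF_lower)
  then have "\<not> (\<forall>t. \<phi> (\<eta> (\<Psi> (\<omega> t))) \<le> c - \<epsilon>)"
    using \<open>0 < \<epsilon>\<close> SUP_least[of UNIV "\<lambda>t. ereal (\<phi> ((\<eta> \<circ> (\<Psi> \<circ> \<omega>)) t))" "ereal (c - \<epsilon>)"]
    by (auto dest: order_trans)
  then obtain t where t: "\<phi> (\<eta> (\<Psi> (\<omega> t))) > c - \<epsilon>" by (auto simp: not_le)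
  have "\<exists>v\<in>K. dist v (\<Psi> (\<omega> t)) \<le> 2 * \<delta>" using \<eta>(5)[OF \<Psi>_le, of t] t by (force simp: not_le)
  then obtain v where v: "v \<in> K" "norm (v - \<Psi> (\<omega> t)) \<le> 2 * \<delta>" by (auto simp: dist_norm)
  \<comment> \<open>Neither \<eta> nor \<Psi> raises the level, so the same \<open>t\<close>
    witnesses that the first application of \<eta> also failed to reach c - \<epsilon>.\<close>
  have "\<phi> (\<omega> t) > c - \<epsilon>" using t \<eta>(3)[OF \<Psi>_le, of t] assms(9)[of "\<omega> t"] by simp
  then have "\<exists>u\<in>K. dist u (\<gamma> t) \<le> 2 * \<delta>" using \<eta>(5)[OF \<gamma>_le, of t] by (force simp: not_le \<omega>_def)
  then obtain u where u: "u \<in> K" "dist u (\<gamma> t) \<le> 2 * \<delta>" by blast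
  have \<omega>: "dist (\<omega> t) (\<gamma> t) \<le> \<delta>" using \<eta>(2)[OF \<gamma>_le] by (simp add: \<omega>_def)
  then have "norm (u - \<omega> t) \<le> 3 * \<delta>"
    using u(2) dist_triangle2[of u "\<omega> t" "\<gamma> t"] by (simp add: dist_norm)
  moreover have "infdist (\<omega> t) (range \<gamma>) \<le> \<delta>" using infdist_le2[OF rangeI[of \<gamma> t] \<omega>] .
  ultimately show ?thesis using u(1) v unfolding K_def by blast
qed

end
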